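(* Suppose that $u\in F_{USCG}(\mathbb{R}^m)$, and let $u(\cdot):(0,1]\to(K(\mathbb{R}^m)\cup\{\emptyset\},H)$ be the function defined by $u(\alpha)=[u]_\alpha$. Let $\alpha\in(0,1)$. Then the following statements are true. (i) $H([u]_\beta,\overline{\{u>\alpha\}})\to0$ as $\beta\to\alpha+$. (ii) $u(\cdot)$ is left-continuous at $\alpha$, i.e. $H([u]_\beta,[u]_\alpha)\to0$ as $\beta\to\alpha-$. (iii) $\alpha\in P(u)$ if and only if $\alpha$ is a discontinuous point of the function $u(\cdot)$.
   Context: A fuzzy set on $\mathbb{R}^m$ is a function $u:\mathbb{R}^m\to[0,1]$. For $\alpha\in(0,1]$, $[u]_\alpha=\{x:u(x)\ge\alpha\}$ and $\{u>\alpha\}=\{x:u(x)>\alpha\}$. $F_{USCG}(\mathbb{R}^m)$ is the set of all upper semi-continuous fuzzy sets $u$ on $\mathbb{R}^m$ with $[u]_\alpha$ bounded for each $\alpha\in(0,1]$ (cuts may be empty). $P(u)$ is the set of platform points of $u$: those $\alpha\in(0,1)$ with $\overline{\{u>\alpha\}}\subsetneqq[u]_\alpha$. $K(\mathbb{R}^m)$ is the set of all nonempty compact subsets of $\mathbb{R}^m$. $H$ is the Hausdorff metric, $H(A,B)=\max\{\sup_{a\in A}\inf_{b\in B}d(a,b),\ \sup_{b\in B}\inf_{a\in A}d(a,b)\}$ for nonempty closed sets, extended to the empty set by $H(\emptyset,\emptyset)=0$ and $H(\emptyset,A)=H(A,\emptyset)=+\infty$ for $A\ne\emptyset$. *)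

theory Defs
  imports "HOL-Analysis.Analysis"
begin

definition upper_semicontinuous :: "('a::topological_space \<Rightarrow> real) \<Rightarrow> bool" where
  "upper_semicontinuous u \<longleftrightarrow> (\<forall>x. \<forall>c > u x. \<forall>\<^sub>F y in nhds x. u y < c)"

definition fuzzy_set :: "('a \<Rightarrow> real) \<Rightarrow> bool" where
  "fuzzy_set u \<longleftrightarrow> (\<forall>x. 0 \<le> u x \<and> u x \<le> 1)"

definition level_cut :: "('a \<Rightarrow> real) \<Rightarrow> real \<Rightarrow> 'a set" where
  "level_cut u \<alpha> = {x. u x \<ge> \<alpha>}"

definition strict_cut :: "('a \<Rightarrow> real) \<Rightarrow> real \<Rightarrow> 'a set" where
  "strict_cut u \<alpha> = {x. u x > \<alpha>}"

definition F_USCG :: "('a::metric_space \<Rightarrow> real) set" where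
  "F_USCG = {u. fuzzy_set u \<and> upper_semicontinuous u \<and> (\<forall>\<alpha>\<in>{0<..1}. bounded (level_cut u \<alpha>))}"

definition platform_points :: "('a::topological_space \<Rightarrow> real) \<Rightarrow> real set" where
  "platform_points u = {\<alpha>\<in>{0<..<1}. closure (strict_cut u \<alpha>) \<subset> level_cut u \<alpha>}"

definition hausdorff_dist :: "'a::metric_space set \<Rightarrow> 'a set \<Rightarrow> ennreal" where
  "hausdorff_dist A B =
    (if A = {} \<and> B = {} then 0
     else if A = {} \<or> B = {} then \<infinity>
     else max (SUP a\<in>A. INF b\<in>B. ennreal (dist a b)) (SUP b\<in>B. INF a\<in>A. ennreal (dist a b)))"

(* The Hausdorff distance takes the value \<infinity>, so the spaces of sets below carry no metric_space instance,
   and convergence is expressed as convergence of the distance to 0. *)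

definition hausdorff_tendsto :: "(real \<Rightarrow> 'a::metric_space set) \<Rightarrow> 'a set \<Rightarrow> real filter \<Rightarrow> bool" where
  "hausdorff_tendsto S A F \<longleftrightarrow> ((\<lambda>\<beta>. hausdorff_dist (S \<beta>) A) \<longlongrightarrow> 0) F"

definition hausdorff_continuous_at :: "real set \<Rightarrow> (real \<Rightarrow> 'a::metric_space set) \<Rightarrow> real \<Rightarrow> bool" where
  "hausdorff_continuous_at D S \<alpha> \<longleftrightarrow> hausdorff_tendsto S (S \<alpha>) (at \<alpha> within D)"

definition discontinuity_point :: "real set \<Rightarrow> (real \<Rightarrow> 'a::metric_space set) \<Rightarrow> real \<Rightarrow> bool" where
  "discontinuity_point D S \<alpha> \<longleftrightarrow> \<alpha> \<in> D \<and> \<not> hausdorff_continuous_at D S \<alpha>"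

definition compact_or_empty :: "'a::topological_space set set" where
  "compact_or_empty = {A. A \<noteq> {} \<and> compact A} \<union> {{}}"

lemma closed_level_cut:
  assumes "upper_semicontinuous u"
  shows "closed (level_cut u \<alpha>)"
proof -
  have "open {x. u x < \<alpha>}"
    unfolding open_subopen[of "{x. u x < \<alpha>}"]
    using assms by (fastforce simp: upper_semicontinuous_def eventually_nhds)
  moreover have "- level_cut u \<alpha> = {x. u x < \<alpha>}"
    by (auto simp: level_cut_def)
  ultimately show ?thesis
    by (simp add: closed_def)
qed

lemma level_cut_in_compact_or_empty:
  fixes u :: "'a::heine_borel \<Rightarrow> real"
  assumes "u \<in> F_USCG"
  shows "level_cut u \<in> {0<..1} \<rightarrow> compact_or_empty"
  using assms closed_level_cut by (auto simp: F_USCG_def compact_or_empty_def compact_eq_bounded_closed)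

lemma closure_strict_cut_subset_cut:
  assumes "upper_semicontinuous u"
  shows "closure (strict_cut u \<alpha>) \<subseteq> level_cut u \<alpha>"
  by (rule closure_minimal) (auto simp: strict_cut_def level_cut_def closed_level_cut[OF assms, unfolded level_cut_def])

end

theory Submission
  imports Defs
begin

text \<open>
  The cuts \<open>[u]\<^sub>\<beta>\<close> decrease in \<open>\<beta>\<close>, so along each one-sided limit the cut and its claimed limit
  are nested, and convergence in the Hausdorff distance amounts to a single covering statement
  about the larger of the two sets. Both coverings come from compactness, which cuts at positive
  levels enjoy because \<open>u\<close> is upper semi-continuous with bounded cuts.

  From the right, the compact set \<open>closure {u > \<alpha>}\<close> is covered by finitely many \<open>e\<close>-balls with
  centres in \<open>{u > \<alpha>}\<close>, and all these centres lie in \<open>[u]\<^sub>\<beta>\<close> once \<open>\<beta>\<close> is close to \<open>\<alpha>\<close>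
  (\<open>level_cut_tendsto_at_right\<close>). From the left (\<open>level_cut_tendsto_at_left\<close>), what remains of a cut at a
  positive level below \<open>\<alpha>\<close> outside the \<open>e\<close>-neighbourhood of \<open>[u]\<^sub>\<alpha>\<close> is compact, and
  \<open>u < \<alpha>\<close> there; an upper semi-continuous function on a compact set stays uniformly below such
  a bound, so \<open>[u]\<^sub>\<beta>\<close> misses this remainder once \<open>\<beta>\<close> is close to \<open>\<alpha>\<close>.

  Hence \<open>u(\<cdot>)\<close> is continuous at \<open>\<alpha>\<close> exactly when \<open>[u]\<^sub>\<alpha>\<close> is also its limit from the right, and
  as limits of closed sets are unique, exactly when \<open>closure {u > \<alpha>} = [u]\<^sub>\<alpha>\<close>
  (\<open>hausdorff_continuous_at_level_cut_iff\<close>). Since \<open>closure {u > \<alpha>} \<subseteq> [u]\<^sub>\<alpha>\<close> always holds, failure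
  of this equality is the definition of a platform point.
\<close>

text \<open>
  The two existence claims force \<open>A\<close> and \<open>B\<close> to be empty together, which rules out the infinite
  value of the distance; otherwise each of them bounds one of the two suprema.
\<close>

lemma hausdorff_dist_le:
  assumes "\<And>a. a \<in> A \<Longrightarrow> \<exists>b\<in>B. dist a b \<le> e"
    and "\<And>b. b \<in> B \<Longrightarrow> \<exists>a\<in>A. dist a b \<le> e"
  shows "hausdorff_dist A B \<le> ennreal e"
proof (cases "A = {} \<or> B = {}")
  case True
  then have "A = {}" "B = {}"
    using assms by auto
  then show ?thesis
    by (simp add: hausdorff_dist_def)
next
  case False
  have "(INF b\<in>B. ennreal (dist a b)) \<le> ennreal e" if "a \<in> A" for a
    using assms(1)[OF that] by (meson INF_lower2 ennreal_leI)
  moreover have "(INF a\<in>A. ennreal (dist a b)) \<le> ennreal e" if "b \<in> B" for b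
    using assms(2)[OF that] by (meson INF_lower2 ennreal_leI)
  ultimately show ?thesis
    using False by (auto simp: hausdorff_dist_def intro!: SUP_least)
qed

lemma hausdorff_dist_less_imp_close:
  assumes "hausdorff_dist A B < ennreal e" "b \<in> B"
  shows "\<exists>a\<in>A. dist a b < e"
proof -
  have "A \<noteq> {}" "B \<noteq> {}"
    using assms by (auto simp: hausdorff_dist_def split: if_splits)
  then have "(SUP b\<in>B. INF a\<in>A. ennreal (dist a b)) < ennreal e"
    using assms by (auto simp: hausdorff_dist_def)
  then have "(INF a\<in>A. ennreal (dist a b)) < ennreal e"
    using assms(2) by (meson SUP_upper le_less_trans)
  then obtain a where "a \<in> A" "ennreal (dist a b) < ennreal e"
    by (auto simp: INF_less_iff)
  then show ?thesis
    by (auto simp: ennreal_less_iff)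
qed

lemma hausdorff_tendstoI:
  assumes "\<And>e. e > 0 \<Longrightarrow> \<forall>\<^sub>F \<beta> in F. \<forall>a\<in>S \<beta>. \<exists>b\<in>A. dist a b \<le> e"
    and "\<And>e. e > 0 \<Longrightarrow> \<forall>\<^sub>F \<beta> in F. \<forall>b\<in>A. \<exists>a\<in>S \<beta>. dist a b \<le> e"
  shows "hausdorff_tendsto S A F"
  unfolding hausdorff_tendsto_def
proof (rule order_tendstoI)
  fix y :: ennreal
  assume "0 < y"
  then obtain r where "0 < r" "r < y"
    using dense by blast
  then obtain e where e: "0 < e" "ennreal e < y"
    by (cases r) (auto simp: ennreal_less_iff)
  show "\<forall>\<^sub>F \<beta> in F. hausdorff_dist (S \<beta>) A < y"
    using assms[OF e(1)]
  proof eventually_elim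
    case (elim \<beta>)
    then have "hausdorff_dist (S \<beta>) A \<le> ennreal e"
      by (intro hausdorff_dist_le) auto
    with e(2) show ?case
      by order
  qed
qed simp

lemma hausdorff_tendstoD:
  assumes "hausdorff_tendsto S A F" "e > 0"
  shows "\<forall>\<^sub>F \<beta> in F. hausdorff_dist (S \<beta>) A < ennreal e"
  using assms by (auto simp: hausdorff_tendsto_def intro: order_tendstoD)

lemma compact_level_cut:
  fixes u :: "'a::heine_borel \<Rightarrow> real"
  assumes "u \<in> F_USCG" "\<alpha> \<in> {0<..1}"
  shows "compact (level_cut u \<alpha>)"
  using assms closed_level_cut by (auto simp: F_USCG_def compact_eq_bounded_closed)

text \<open>
  A finite \<open>e\<close>-net of \<open>closure {u > \<alpha>}\<close> can be taken inside \<open>{u > \<alpha>}\<close>, and then \<open>u\<close> has a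
  minimum on it that exceeds \<open>\<alpha>\<close>: below that minimum, every cut contains the whole net.
\<close>

lemma level_cut_tendsto_at_right:
  fixes u :: "'a::heine_borel \<Rightarrow> real"
  assumes u: "u \<in> F_USCG" and \<alpha>: "\<alpha> \<in> {0<..1}"
  shows "hausdorff_tendsto (level_cut u) (closure (strict_cut u \<alpha>)) (at_right \<alpha>)"
proof (rule hausdorff_tendstoI)
  fix e :: real
  assume "e > 0"
  show "\<forall>\<^sub>F \<beta> in at_right \<alpha>. \<forall>a\<in>level_cut u \<beta>. \<exists>b\<in>closure (strict_cut u \<alpha>). dist a b \<le> e"
    using eventually_at_right_less
  proof eventually_elim
    case (elim \<beta>)
    then have "level_cut u \<beta> \<subseteq> closure (strict_cut u \<alpha>)"
      using closure_subset by (fastforce simp: level_cut_def strict_cut_def)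
    with \<open>e > 0\<close> show ?case
      by (metis dist_self less_imp_le subsetD)
  qed
  have "upper_semicontinuous u"
    using u by (simp add: F_USCG_def)
  from closure_strict_cut_subset_cut[OF this] have "compact (closure (strict_cut u \<alpha>))"
    using compact_level_cut[OF u \<alpha>] closed_closure by (metis compact_Int_closed inf.absorb_iff2)
  moreover have "closure (strict_cut u \<alpha>) \<subseteq> (\<Union>x\<in>strict_cut u \<alpha>. ball x e)"
    using \<open>e > 0\<close> by (auto simp: closure_approachable)
  ultimately obtain D where D: "D \<subseteq> strict_cut u \<alpha>" "finite D"
      "closure (strict_cut u \<alpha>) \<subseteq> (\<Union>x\<in>D. ball x e)"
    using compactE_image[of "closure (strict_cut u \<alpha>)" "strict_cut u \<alpha>" "\<lambda>x. ball x e"]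
    by (metis open_ball)
  have "\<forall>x\<in>D. \<forall>\<^sub>F \<beta> in at_right \<alpha>. \<beta> < u x"
    using D(1) by (auto simp: strict_cut_def intro: order_tendstoD(2)[OF tendsto_ident_at])
  then have "\<forall>\<^sub>F \<beta> in at_right \<alpha>. \<forall>x\<in>D. \<beta> < u x"
    by (rule eventually_ball_finite[OF D(2)])
  then show "\<forall>\<^sub>F \<beta> in at_right \<alpha>. \<forall>b\<in>closure (strict_cut u \<alpha>). \<exists>a\<in>level_cut u \<beta>. dist a b \<le> e"
  proof eventually_elim
    case (elim \<beta>)
    show ?case
    proof
      fix b
      assume "b \<in> closure (strict_cut u \<alpha>)"
      with D(3) obtain x where "x \<in> D" "dist x b < e"
        by auto
      with elim show "\<exists>a\<in>level_cut u \<beta>. dist a b \<le> e"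
        by (auto simp: level_cut_def intro!: bexI[of _ x] less_imp_le)
    qed
  qed
qed

text \<open>
  This holds because an upper semi-continuous function attains its maximum on a nonempty compact
  set; stating it with varying bounds instead of a maximum includes the empty set.
\<close>

lemma upper_semicontinuous_less_on_compact:
  assumes u: "upper_semicontinuous u" and K: "compact K"
    and less: "\<And>x. x \<in> K \<Longrightarrow> u x < \<alpha>"
  shows "\<forall>\<^sub>F \<beta> in at_left \<alpha>. \<forall>x\<in>K. u x < \<beta>"
proof -
  have "open {x. u x < c}" for c
    using closed_level_cut[OF u, of c] by (simp add: level_cut_def closed_def Collect_neg_eq[symmetric] not_le)
  moreover have "K \<subseteq> (\<Union>c\<in>{..<\<alpha>}. {x. u x < c})"
    using less dense by fastforce
  ultimately obtain C where C: "C \<subseteq> {..<\<alpha>}" "finite C" "K \<subseteq> (\<Union>c\<in>C. {x. u x < c})"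
    using compactE_image[OF K, of "{..<\<alpha>}" "\<lambda>c. {x. u x < c}"] by metis
  have "\<forall>c\<in>C. \<forall>\<^sub>F \<beta> in at_left \<alpha>. c < \<beta>"
    using C(1) by (auto intro: order_tendstoD(1)[OF tendsto_ident_at])
  then have "\<forall>\<^sub>F \<beta> in at_left \<alpha>. \<forall>c\<in>C. c < \<beta>"
    by (rule eventually_ball_finite[OF C(2)])
  then show ?thesis
    by eventually_elim (use C(3) in fastforce)
qed

lemma level_cut_tendsto_at_left:
  fixes u :: "'a::heine_borel \<Rightarrow> real"
  assumes u: "u \<in> F_USCG" and \<alpha>: "\<alpha> \<in> {0<..1}"
  shows "hausdorff_tendsto (level_cut u) (level_cut u \<alpha>) (at_left \<alpha>)"
proof (rule hausdorff_tendstoI)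
  fix e :: real
  assume "e > 0"
  have "\<forall>\<^sub>F \<beta> in at_left \<alpha>. \<beta> < \<alpha>"
    by (simp add: eventually_at_filter)
  then show "\<forall>\<^sub>F \<beta> in at_left \<alpha>. \<forall>b\<in>level_cut u \<alpha>. \<exists>a\<in>level_cut u \<beta>. dist a b \<le> e"
  proof eventually_elim
    case (elim \<beta>)
    then have "level_cut u \<alpha> \<subseteq> level_cut u \<beta>"
      by (auto simp: level_cut_def)
    with \<open>e > 0\<close> show ?case
      by (metis dist_self less_imp_le subsetD)
  qed
  \<comment> \<open>The level \<open>\<alpha> / 2\<close> only serves to confine the nearby cuts to one compact set.\<close>
  define K where "K = level_cut u (\<alpha> / 2) - (\<Union>x\<in>level_cut u \<alpha>. ball x e)"
  have "compact K"
    unfolding K_def using \<alpha> by (intro compact_diff compact_level_cut[OF u] open_UN) auto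
  moreover have "u x < \<alpha>" if "x \<in> K" for x
    using that \<open>e > 0\<close> by (force simp: K_def level_cut_def not_le[symmetric])
  ultimately have "\<forall>\<^sub>F \<beta> in at_left \<alpha>. \<forall>x\<in>K. u x < \<beta>"
    using u by (intro upper_semicontinuous_less_on_compact) (auto simp: F_USCG_def)
  moreover have "\<forall>\<^sub>F \<beta> in at_left \<alpha>. \<alpha> / 2 < \<beta>"
    using \<alpha> by (intro order_tendstoD(1)[OF tendsto_ident_at]) auto
  ultimately show "\<forall>\<^sub>F \<beta> in at_left \<alpha>. \<forall>a\<in>level_cut u \<beta>. \<exists>b\<in>level_cut u \<alpha>. dist a b \<le> e"
  proof eventually_elim
    case (elim \<beta>)
    show ?case
    proof
      fix a
      assume "a \<in> level_cut u \<beta>"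
      with elim have "a \<in> level_cut u (\<alpha> / 2)" "a \<notin> K"
        by (auto simp: level_cut_def)
      then show "\<exists>b\<in>level_cut u \<alpha>. dist a b \<le> e"
        by (auto simp: K_def dist_commute intro: less_imp_le)
    qed
  qed
qed

text \<open>
  Approximating a point of \<open>[u]\<^sub>\<alpha>\<close> by points of \<open>[u]\<^sub>\<beta>\<close> with \<open>\<beta> > \<alpha>\<close> approximates it by points
  of \<open>{u > \<alpha>}\<close>. This yields the needed instance of uniqueness of limits without a triangle
  inequality for the Hausdorff distance.
\<close>

lemma level_cut_subset_closure_strict_cut:
  assumes "hausdorff_tendsto (level_cut u) (level_cut u \<alpha>) (at_right \<alpha>)"
  shows "level_cut u \<alpha> \<subseteq> closure (strict_cut u \<alpha>)"
proof
  fix x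
  assume x: "x \<in> level_cut u \<alpha>"
  have "\<exists>y\<in>strict_cut u \<alpha>. dist y x < e" if "e > 0" for e
  proof -
    have "\<forall>\<^sub>F \<beta> in at_right \<alpha>. hausdorff_dist (level_cut u \<beta>) (level_cut u \<alpha>) < ennreal e \<and> \<alpha> < \<beta>"
      by (intro eventually_conj hausdorff_tendstoD[OF assms that] eventually_at_right_less)
    then obtain \<beta> where "hausdorff_dist (level_cut u \<beta>) (level_cut u \<alpha>) < ennreal e" "\<alpha> < \<beta>"
      using eventually_happens trivial_limit_at_right_real by blast
    then obtain y where "y \<in> level_cut u \<beta>" "dist y x < e"
      using hausdorff_dist_less_imp_close x by blast
    with \<open>\<alpha> < \<beta>\<close> show ?thesis
      by (auto simp: level_cut_def strict_cut_def intro!: exI[of _ y])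
  qed
  then show "x \<in> closure (strict_cut u \<alpha>)"
    by (auto simp: closure_approachable)
qed

lemma hausdorff_continuous_at_level_cut_iff:
  fixes u :: "'a::heine_borel \<Rightarrow> real"
  assumes u: "u \<in> F_USCG" and \<alpha>: "\<alpha> \<in> {0<..<1}"
  shows "hausdorff_continuous_at {0<..1} (level_cut u) \<alpha> \<longleftrightarrow>
    closure (strict_cut u \<alpha>) = level_cut u \<alpha>"
proof -
  have "\<alpha> \<in> interior {0<..1}"
    using \<alpha> by (intro interiorI[of "{0<..<1}"]) auto
  then have "at \<alpha> within {0<..1} = at \<alpha>"
    by (rule at_within_interior)
  then have "hausdorff_continuous_at {0<..1} (level_cut u) \<alpha> \<longleftrightarrow>
      hausdorff_tendsto (level_cut u) (level_cut u \<alpha>) (at_right \<alpha>)"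
    using level_cut_tendsto_at_left[OF u, of \<alpha>] \<alpha>
    by (simp add: hausdorff_continuous_at_def hausdorff_tendsto_def filterlim_at_split)
  also have "\<dots> \<longleftrightarrow> closure (strict_cut u \<alpha>) = level_cut u \<alpha>"
  proof
    assume "hausdorff_tendsto (level_cut u) (level_cut u \<alpha>) (at_right \<alpha>)"
    then show "closure (strict_cut u \<alpha>) = level_cut u \<alpha>"
      using level_cut_subset_closure_strict_cut[of u \<alpha>] closure_strict_cut_subset_cut[of u \<alpha>] u
      by (auto simp: F_USCG_def)
  next
    assume "closure (strict_cut u \<alpha>) = level_cut u \<alpha>"
    then show "hausdorff_tendsto (level_cut u) (level_cut u \<alpha>) (at_right \<alpha>)"
      using level_cut_tendsto_at_right[OF u, of \<alpha>] \<alpha> by simp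
  qed
  finally show ?thesis .
qed

theorem theorem5p4:
  fixes u :: "real ^ 'm \<Rightarrow> real" and \<alpha> :: real
  assumes "u \<in> F_USCG" and "\<alpha> \<in> {0<..<1}"
  shows "hausdorff_tendsto (level_cut u) (closure (strict_cut u \<alpha>)) (at_right \<alpha>) \<and>
    hausdorff_tendsto (level_cut u) (level_cut u \<alpha>) (at_left \<alpha>) \<and>
    (\<alpha> \<in> platform_points u \<longleftrightarrow> discontinuity_point {0<..1} (level_cut u) \<alpha>)"
proof -
  have \<alpha>: "\<alpha> \<in> {0<..1}"
    using assms(2) by simp
  have "closure (strict_cut u \<alpha>) \<subseteq> level_cut u \<alpha>"
    using assms(1) by (intro closure_strict_cut_subset_cut) (simp add: F_USCG_def)
  then have "\<alpha> \<in> platform_points u \<longleftrightarrow> discontinuity_point {0<..1} (level_cut u) \<alpha>"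
    using hausdorff_continuous_at_level_cut_iff[OF assms] assms(2) \<alpha>
    by (auto simp: platform_points_def discontinuity_point_def)
  then show ?thesis
    using level_cut_tendsto_at_right[OF assms(1) \<alpha>] level_cut_tendsto_at_left[OF assms(1) \<alpha>]
    by blast
qed

end
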